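(* Let $d\ge 1$ be an integer and let $\bar\alpha=\langle\alpha_1,\dots,\alpha_d\rangle$ and $\bar\beta=\langle\beta_1,\dots,\beta_d\rangle$ be vectors in $\mathbb{R}^d$. Suppose that for every integer $n\ge 1$, $$\prod_{i=1}^d \lfloor n\alpha_i\rfloor=\prod_{i=1}^d \lfloor n\beta_i\rfloor .$$ Then either some $\alpha_i$ is an integer, or $\{\alpha_1,\dots,\alpha_d\}=\{\beta_1,\dots,\beta_d\}$ as multisets. *)

theory Defs
  imports "HOL-Analysis.Analysis" "HOL-Library.Multiset"
begin

end

theory Submission
  imports Defs "HOL-Computational_Algebra.Polynomial" "HOL-Number_Theory.Cong"
begin

text \<open>
  The idea is to read the product of floors as the value at \<open>n\<close> of the polynomial
  \<open>\<Prod>\<^sub>i (a\<^sub>i X - frac (n a\<^sub>i))\<close>, whose coefficients depend on \<open>n\<close> only through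
  fractional parts. By Dirichlet's simultaneous approximation theorem the vector of fractional parts
  at a given \<open>n \<ge> 1\<close> is approached again along arbitrarily large integers. The
  difference of the polynomials for \<open>\<alpha>\<close> and \<open>\<beta>\<close> vanishes at \<open>X = n\<close>
  for every \<open>n \<ge> 1\<close>; along such a recurrent sequence its argument tends to infinity while
  its coefficients converge, so its leading coefficient must be zero. Peeling off the coefficients
  from the top, the two polynomials coincide for every \<open>n \<ge> 1\<close>
  (\<open>floor_poly_eq_if_floor_products_eq\<close>). Comparing roots, the multisets of the numbers
  \<open>frac (n \<alpha>\<^sub>i) / \<alpha>\<^sub>i\<close> and \<open>frac (n \<beta>\<^sub>i) / \<beta>\<^sub>i\<close> agree
  for every \<open>n \<ge> 1\<close>. For \<open>n = 1\<close> this shows that no \<open>\<beta>\<^sub>i\<close> is an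
  integer if no \<open>\<alpha>\<^sub>i\<close> is.

  It remains to recover a finite multiset of non-integers from these scaled fractional parts. After
  cancelling common elements it suffices that two finite sets, not both empty, with the same
  scaled fractional parts for all \<open>n\<close> share an element
  (\<open>scaled_frac_images_common_element\<close>). If one of them contains an irrational \<open>x\<close>,
  choose \<open>n\<close> such that \<open>n y\<close> is close to an integer for every \<open>y\<close> occurring
  and \<open>frac (n x)\<close> is close to \<open>1\<close>: all scaled fractional parts are then close
  to \<open>0\<close> or to some \<open>1 / y\<close>, and since one of them is close to \<open>1 / x\<close> in
  the set of \<open>x\<close>, the other set must contain \<open>x\<close> as well. If all elements are
  rational, take a fraction \<open>p / q\<close> in lowest terms with \<open>\<bar>p\<bar>\<close> maximal and then
  \<open>q\<close> maximal, and let \<open>j\<close> be the largest number below \<open>q\<close> that is coprime to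
  \<open>p\<close>. The value \<open>j / p\<close> is attained by \<open>p / q\<close> for some \<open>n\<close>, and
  maximality prevents every other fraction from attaining it.
\<close>

section \<open>Recurrence of fractional parts\<close>

text \<open>
  Applying Dirichlet's theorem to the multiples \<open>K \<theta>\<close> makes the common denominator divisible
  by \<open>K\<close>, and hence as large as desired.
\<close>

lemma simultaneous_recurrence:
  fixes U :: "real set" and \<epsilon> :: real and K :: nat
  assumes U: "finite U" and \<epsilon>: "\<epsilon> > 0" and K: "K \<ge> 1"
  obtains m :: nat where "m \<ge> 1" "K dvd m" "\<And>\<theta>. \<theta> \<in> U \<Longrightarrow> \<exists>p::int. \<bar>real m * \<theta> - of_int p\<bar> < \<epsilon>"
proof -
  obtain f where f: "bij_betw f {..<card U} U"
    using ex_bij_betw_nat_finite[OF U] by (auto simp: atLeast0LessThan)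
  obtain N :: nat where N: "N > 0" "1 / real N < \<epsilon>"
    using real_arch_inverse[of \<epsilon>] \<epsilon> by (auto simp: inverse_eq_divide)
  obtain q p where q: "0 < q" "q \<le> int (N ^ card U)"
    and approx: "\<And>i. i < card U \<Longrightarrow> \<bar>of_int q * (real K * f i) - of_int (p i)\<bar> < 1 / N"
    using Dirichlet_approx_simult[OF N(1), where n = "card U" and \<theta> = "\<lambda>i. real K * f i"]
    by blast
  show thesis
  proof (rule that[of "nat q * K"])
    show "nat q * K \<ge> 1" using q K by (simp add: Suc_leI)
    fix \<theta> assume "\<theta> \<in> U"
    then obtain i where i: "i < card U" "\<theta> = f i"
      using f by (metis bij_betw_iff_bijections lessThan_iff)
    have "\<bar>real (nat q * K) * \<theta> - of_int (p i)\<bar> < \<epsilon>"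
      using approx[OF i(1)] N(2) q i by (simp add: mult.assoc)
    then show "\<exists>p::int. \<bar>real (nat q * K) * \<theta> - of_int p\<bar> < \<epsilon>" by blast
  qed simp
qed

text \<open>
  Near an integer \<open>frac\<close> jumps, so approximate return of \<open>n \<theta>\<close> does not suffice when
  \<open>n \<theta>\<close> is an integer. Returning by multiples of \<open>n\<close> avoids the problem: they
  keep such a \<open>\<theta>\<close> exactly at fractional part \<open>0\<close>.
\<close>

lemma frac_recurrence_sequence:
  fixes U :: "real set" and n :: nat
  assumes U: "finite U" and n: "n \<ge> 1"
  obtains r :: "nat \<Rightarrow> nat" where "filterlim r at_top sequentially"
    "\<And>\<theta>. \<theta> \<in> U \<Longrightarrow> (\<lambda>k. frac (real (r k) * \<theta>)) \<longlonglongrightarrow> frac (real n * \<theta>)"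
proof -
  have "\<exists>m. m \<ge> 1 \<and> n * Suc k dvd m \<and> (\<forall>\<theta>\<in>U. \<exists>p::int. \<bar>real m * \<theta> - of_int p\<bar> < 1 / real (Suc k))" for k
    by (rule simultaneous_recurrence[OF U, of "1 / real (Suc k)" "n * Suc k"]) (use n in auto)
  then obtain m where m: "\<And>k. m k \<ge> 1" "\<And>k. n * Suc k dvd m k"
    and approx: "\<And>k \<theta>. \<theta> \<in> U \<Longrightarrow> \<exists>p::int. \<bar>real (m k) * \<theta> - of_int p\<bar> < 1 / real (Suc k)"
    by metis
  have ge: "k \<le> n + m k" for k
    using dvd_imp_le[OF m(2)[of k]] m(1)[of k] n
    by (metis Suc_leD add.commute le_trans le_add1 less_le_trans mult_le_mono1 nat_mult_1 zero_less_one)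
  show thesis
  proof (rule that[of "\<lambda>k. n + m k"])
    show "filterlim (\<lambda>k. n + m k) at_top sequentially"
      by (rule filterlim_at_top_mono[OF filterlim_ident]) (use ge in auto)
    fix \<theta> assume \<theta>: "\<theta> \<in> U"
    show "(\<lambda>k. frac (real (n + m k) * \<theta>)) \<longlonglongrightarrow> frac (real n * \<theta>)"
    proof (cases "real n * \<theta> \<in> \<int>")
      case True
      have "real (m k) * \<theta> \<in> \<int>" for k
      proof -
        obtain c where "m k = n * c" using m(2)[of k] by (metis dvdE mult.assoc)
        then have "real (m k) * \<theta> = real c * (real n * \<theta>)" by simp
        then show ?thesis using True by (metis Ints_mult Ints_of_nat)
      qed
      then have "frac (real (n + m k) * \<theta>) = frac (real n * \<theta>)" for k
        by (simp add: distrib_right frac_add_int_right)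
      then show ?thesis by simp
    next
      case False
      obtain p :: "nat \<Rightarrow> int" where p: "\<And>k. \<bar>real (m k) * \<theta> - of_int (p k)\<bar> < 1 / real (Suc k)"
        using approx[OF \<theta>] by metis
      have "(\<lambda>k. real (m k) * \<theta> - of_int (p k)) \<longlonglongrightarrow> 0"
      proof (rule Lim_null_comparison)
        show "\<forall>\<^sub>F k in sequentially. norm (real (m k) * \<theta> - of_int (p k)) \<le> 1 / real (Suc k)"
          using p by (auto intro!: always_eventually less_imp_le)
        show "(\<lambda>k. 1 / real (Suc k)) \<longlonglongrightarrow> 0"
          using LIMSEQ_inverse_real_of_nat by (simp add: inverse_eq_divide)
      qed
      from tendsto_add[OF tendsto_const this]
      have "(\<lambda>k. real n * \<theta> + (real (m k) * \<theta> - of_int (p k))) \<longlonglongrightarrow> real n * \<theta>"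
        by simp
      from isCont_tendsto_compose[OF continuous_frac[OF False] this]
      have "(\<lambda>k. frac (real n * \<theta> + (real (m k) * \<theta> - of_int (p k)))) \<longlonglongrightarrow> frac (real n * \<theta>)" .
      moreover have "frac (real n * \<theta> + (real (m k) * \<theta> - of_int (p k))) = frac (real (n + m k) * \<theta>)" for k
        using frac_add_of_int_right[of "real (n + m k) * \<theta>" "- p k"] by (simp add: algebra_simps)
      ultimately show ?thesis by simp
    qed
  qed
qed

text \<open>
  A near-return time \<open>m1\<close> may put \<open>x\<close> slightly above an integer, at distance
  \<open>\<delta> > 0\<close>, positive because \<open>x\<close> is irrational. If \<open>m2\<close> is a
  return time of precision \<open>\<delta>\<close>, then \<open>m2 - m1\<close> puts \<open>x\<close> slightly below an
  integer.
\<close>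

lemma irrational_recurrence_from_below:
  fixes T :: "real set" and \<epsilon> x :: real
  assumes T: "finite T" and \<epsilon>: "\<epsilon> > 0" and x: "x \<notin> \<rat>"
  obtains m :: nat where "m \<ge> 1" "frac (real m * x) > 1 - \<epsilon>"
    "\<And>y. y \<in> T \<Longrightarrow> frac (real m * y) < \<epsilon> \<or> frac (real m * y) > 1 - \<epsilon>"
proof -
  have near: "frac z < \<delta> \<or> frac z > 1 - \<delta>" if "\<bar>z - of_int p\<bar> < \<delta>" for z \<delta> :: real and p :: int
  proof (cases "p \<le> \<lfloor>z\<rfloor>")
    case True
    then show ?thesis using that unfolding frac_def by linarith
  next
    case False
    then have "of_int p \<ge> (of_int \<lfloor>z\<rfloor> + 1 :: real)" by linarith
    then show ?thesis using that unfolding frac_def by linarith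
  qed
  obtain m1 where m1: "m1 \<ge> 1"
    and m1_near: "\<And>y. y \<in> insert x T \<Longrightarrow> \<exists>p::int. \<bar>real m1 * y - of_int p\<bar> < \<epsilon> / 2"
    using simultaneous_recurrence[of "insert x T" "\<epsilon> / 2" 1] T \<epsilon> by auto
  show thesis
  proof (cases "frac (real m1 * x) > 1 - \<epsilon> / 2")
    case True
    show thesis
    proof (rule that[OF m1])
      show "frac (real m1 * x) > 1 - \<epsilon>" using True \<epsilon> by linarith
      fix y assume "y \<in> T"
      then obtain p :: int where "\<bar>real m1 * y - of_int p\<bar> < \<epsilon> / 2" using m1_near by blast
      from near[OF this] show "frac (real m1 * y) < \<epsilon> \<or> frac (real m1 * y) > 1 - \<epsilon>" using \<epsilon> by linarith
    qed
  next
    case False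
    define \<delta> where "\<delta> = frac (real m1 * x)"
    have \<delta>: "\<delta> < \<epsilon> / 2"
      using near m1_near[of x] False unfolding \<delta>_def by blast
    have "real m1 * x \<notin> \<int>"
    proof
      assume "real m1 * x \<in> \<int>"
      then have "real m1 * x / real m1 \<in> \<rat>" by (intro Rats_divide) (auto elim: Ints_cases)
      then show False using x m1 by simp
    qed
    then have \<delta>0: "\<delta> > 0" unfolding \<delta>_def by (simp add: frac_gt_0_iff)
    obtain m2 where m2: "m2 \<ge> 1" "(m1 + 1) dvd m2"
      and m2_near: "\<And>y. y \<in> insert x T \<Longrightarrow> \<exists>p::int. \<bar>real m2 * y - of_int p\<bar> < \<delta>"
      using simultaneous_recurrence[of "insert x T" \<delta> "m1 + 1"] T \<delta>0 by auto
    have "m1 < m2" using dvd_imp_le[OF m2(2)] m2(1) by linarith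
    show thesis
    proof (rule that[of "m2 - m1"])
      show "m2 - m1 \<ge> 1" using \<open>m1 < m2\<close> by simp
      have diff: "real (m2 - m1) * y = real m2 * y - real m1 * y" for y
        using \<open>m1 < m2\<close> by (simp add: of_nat_diff left_diff_distrib)
      obtain p :: int where p: "\<bar>real m2 * x - of_int p\<bar> < \<delta>" using m2_near by blast
      define z where "z = real m2 * x - of_int p - \<delta>"
      have z: "- \<epsilon> < z" "z < 0" using p \<delta> by (auto simp: z_def)
      have "real (m2 - m1) * x = z + of_int (p - \<lfloor>real m1 * x\<rfloor>)"
        unfolding diff z_def \<delta>_def frac_def by simp
      then have "frac (real (m2 - m1) * x) = frac z" by (simp only: frac_add_of_int_right)
      moreover have "frac z \<ge> z + 1"
      proof -
        have "\<lfloor>z\<rfloor> \<le> - 1" using z(2) by linarith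
        then have "real_of_int \<lfloor>z\<rfloor> \<le> - 1" by linarith
        then show ?thesis unfolding frac_def by linarith
      qed
      ultimately show "frac (real (m2 - m1) * x) > 1 - \<epsilon>" using z(1) by linarith
      fix y assume y: "y \<in> T"
      obtain p1 :: int where p1: "\<bar>real m1 * y - of_int p1\<bar> < \<epsilon> / 2" using m1_near y by blast
      obtain p2 :: int where p2: "\<bar>real m2 * y - of_int p2\<bar> < \<delta>" using m2_near y by blast
      have "\<bar>real (m2 - m1) * y - of_int (p2 - p1)\<bar> < \<epsilon>"
        using p1 p2 \<delta> unfolding diff of_int_diff by linarith
      from near[OF this] show "frac (real (m2 - m1) * y) < \<epsilon> \<or> frac (real (m2 - m1) * y) > 1 - \<epsilon>" .
    qed
  qed
qed

section \<open>Polynomials encoding the products of floors\<close>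

lemma tendsto_coeff_prod:
  fixes p :: "nat \<Rightarrow> 'i \<Rightarrow> real poly" and q :: "'i \<Rightarrow> real poly"
  assumes "\<And>i j. i \<in> I \<Longrightarrow> (\<lambda>k. coeff (p k i) j) \<longlonglongrightarrow> coeff (q i) j"
  shows "(\<lambda>k. coeff (\<Prod>i\<in>I. p k i) j) \<longlonglongrightarrow> coeff (\<Prod>i\<in>I. q i) j"
proof -
  have "\<forall>j. (\<lambda>k. coeff (\<Prod>i\<in>I. p k i) j) \<longlonglongrightarrow> coeff (\<Prod>i\<in>I. q i) j"
    using assms
    by (induction I rule: infinite_finite_induct)
      (auto simp: coeff_mult intro!: tendsto_sum tendsto_mult)
  then show ?thesis ..
qed

text \<open>
  Dividing \<open>p\<^sub>k (x\<^sub>k) = 0\<close> by \<open>x\<^sub>k ^ e\<close> leaves the coefficient of degree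
  \<open>e\<close> plus convergent coefficients times negative powers of \<open>x\<^sub>k\<close>.
\<close>

lemma limit_coeff_at_degree_bound_eq_0:
  fixes p :: "nat \<Rightarrow> real poly" and x :: "nat \<Rightarrow> real"
  assumes x: "filterlim x at_top sequentially"
    and root: "\<And>k. poly (p k) (x k) = 0"
    and deg: "\<And>k. degree (p k) \<le> e"
    and lim: "\<And>j. (\<lambda>k. coeff (p k) j) \<longlonglongrightarrow> c j"
  shows "c e = 0"
proof -
  have "(\<lambda>k. coeff (p k) j * inverse (x k) ^ (e - j)) \<longlonglongrightarrow> (if j = e then c e else 0)"
    if "j \<le> e" for j
  proof -
    have "(\<lambda>k. inverse (x k)) \<longlonglongrightarrow> 0"
      by (rule tendsto_inverse_0_at_top[OF x])
    from tendsto_mult[OF lim[of j] tendsto_power[OF this, of "e - j"]]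
    show ?thesis using that by (cases "j = e") (auto simp: power_0_left)
  qed
  then have "(\<lambda>k. \<Sum>j\<le>e. coeff (p k) j * inverse (x k) ^ (e - j)) \<longlonglongrightarrow> (\<Sum>j\<le>e. if j = e then c e else 0)"
    by (intro tendsto_sum) auto
  then have L: "(\<lambda>k. \<Sum>j\<le>e. coeff (p k) j * inverse (x k) ^ (e - j)) \<longlonglongrightarrow> c e"
    by simp
  have "\<forall>\<^sub>F k in sequentially. x k > 0"
    using x by (simp add: filterlim_at_top_dense)
  then have "\<forall>\<^sub>F k in sequentially. (\<Sum>j\<le>e. coeff (p k) j * inverse (x k) ^ (e - j)) = 0"
  proof eventually_elim
    case (elim k)
    have "0 = inverse (x k) ^ e * poly (p k) (x k)"
      by (simp add: root)
    also have "poly (p k) (x k) = (\<Sum>j\<le>e. coeff (p k) j * x k ^ j)"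
      using arg_cong[OF poly_as_sum_of_monoms'[OF deg], of "\<lambda>q. poly q (x k)" k]
      by (simp add: poly_sum poly_monom)
    also have "inverse (x k) ^ e * \<dots> = (\<Sum>j\<le>e. coeff (p k) j * inverse (x k) ^ (e - j))"
      unfolding sum_distrib_left
    proof (rule sum.cong)
      fix j assume "j \<in> {..e}"
      then have "inverse (x k) ^ e = inverse (x k) ^ (e - j) * inverse (x k) ^ j"
        by (simp flip: power_add)
      then show "inverse (x k) ^ e * (coeff (p k) j * x k ^ j) = coeff (p k) j * inverse (x k) ^ (e - j)"
        using elim by (simp add: field_simps)
    qed simp
    finally show ?case by simp
  qed
  then have "(\<lambda>k. \<Sum>j\<le>e. coeff (p k) j * inverse (x k) ^ (e - j)) \<longlonglongrightarrow> 0"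
    by (simp add: tendsto_eventually)
  with L show ?thesis by (rule LIMSEQ_unique)
qed


definition floor_poly :: "'i set \<Rightarrow> ('i \<Rightarrow> real) \<Rightarrow> nat \<Rightarrow> real poly" where
  "floor_poly I a n = (\<Prod>i\<in>I. [:- frac (real n * a i), a i:])"

lemma poly_floor_poly: "poly (floor_poly I a n) (real n) = of_int (\<Prod>i\<in>I. \<lfloor>real n * a i\<rfloor>)"
  by (simp add: floor_poly_def poly_prod frac_def)

lemma degree_floor_poly_le: "degree (floor_poly I a n) \<le> card I"
proof (cases "finite I")
  case True
  have "degree (floor_poly I a n) \<le> (\<Sum>i\<in>I. degree [:- frac (real n * a i), a i:])"
    unfolding floor_poly_def using degree_prod_sum_le[OF True] by (simp only: o_def)
  also have "\<dots> \<le> (\<Sum>i\<in>I. 1)"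
    by (rule sum_mono) simp
  finally show ?thesis by simp
qed (simp add: floor_poly_def)

lemma tendsto_coeff_floor_poly:
  assumes "\<And>i. i \<in> I \<Longrightarrow> (\<lambda>k. frac (real (r k) * a i)) \<longlonglongrightarrow> frac (real n * a i)"
  shows "(\<lambda>k. coeff (floor_poly I a (r k)) j) \<longlonglongrightarrow> coeff (floor_poly I a n) j"
  unfolding floor_poly_def
proof (rule tendsto_coeff_prod)
  fix i j assume "i \<in> I"
  then show "(\<lambda>k. coeff [:- frac (real (r k) * a i), a i:] j) \<longlonglongrightarrow> coeff [:- frac (real n * a i), a i:] j"
    using assms by (cases j) (auto intro: tendsto_minus)
qed

text \<open>
  The coefficient argument has to be run for all \<open>n\<close> simultaneously: one step along the sequence
  of return times requires the degree bound for every polynomial in that sequence, not only for the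
  one at the \<open>n\<close> of interest.
\<close>

lemma floor_poly_eq_if_floor_products_eq:
  fixes a b :: "'i \<Rightarrow> real"
  assumes I: "finite I"
    and eq: "\<And>n::nat. n \<ge> 1 \<Longrightarrow> (\<Prod>i\<in>I. \<lfloor>real n * a i\<rfloor>) = (\<Prod>i\<in>I. \<lfloor>real n * b i\<rfloor>)"
    and n: "n \<ge> 1"
  shows "floor_poly I a n = floor_poly I b n"
proof -
  define D where "D m = floor_poly I a m - floor_poly I b m" for m
  have root: "poly (D m) (real m) = 0" if "m \<ge> 1" for m
    using eq[OF that] by (simp add: D_def poly_floor_poly)
  have top: "coeff (D m) e = 0" if deg: "\<And>m. m \<ge> 1 \<Longrightarrow> degree (D m) \<le> e" and m: "m \<ge> 1" for e m
  proof -
    obtain r :: "nat \<Rightarrow> nat" where r: "filterlim r at_top sequentially"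
      and lim: "\<And>\<theta>. \<theta> \<in> a ` I \<union> b ` I \<Longrightarrow> (\<lambda>k. frac (real (r k) * \<theta>)) \<longlonglongrightarrow> frac (real m * \<theta>)"
      using frac_recurrence_sequence[of "a ` I \<union> b ` I" m] I m by blast
    \<comment> \<open>The polynomials are only known to vanish at positive arguments, so the first terms are dropped.\<close>
    obtain k0 where k0: "\<And>k. k \<ge> k0 \<Longrightarrow> r k \<ge> 1"
      using r unfolding filterlim_at_top eventually_sequentially by blast
    have r': "filterlim (\<lambda>k. r (k + k0)) at_top sequentially"
      using r by (rule filterlim_compose) (rule filterlim_add_const_nat_at_top)
    show ?thesis
    proof (rule limit_coeff_at_degree_bound_eq_0)
      show "filterlim (\<lambda>k. real (r (k + k0))) at_top sequentially"
        using filterlim_compose[OF filterlim_real_sequentially r'] .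
      show "poly (D (r (k + k0))) (real (r (k + k0))) = 0" for k
        by (rule root) (use k0 in simp)
      show "degree (D (r (k + k0))) \<le> e" for k
        by (rule deg) (use k0 in simp)
      show "(\<lambda>k. coeff (D (r (k + k0))) j) \<longlonglongrightarrow> coeff (D m) j" for j
      proof -
        have "(\<lambda>k. coeff (D (r k)) j) \<longlonglongrightarrow> coeff (D m) j"
          unfolding D_def coeff_diff
          by (intro tendsto_diff tendsto_coeff_floor_poly lim) auto
        then show ?thesis by (rule LIMSEQ_ignore_initial_segment)
      qed
    qed
  qed
  have vanish: "D m = 0" if "\<And>m. m \<ge> 1 \<Longrightarrow> degree (D m) \<le> e" "m \<ge> 1" for e m
    using that
  proof (induction e arbitrary: m)
    case 0
    then show ?case using top[of 0 m] leading_coeff_0_iff[of "D m"] by force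
  next
    case (Suc e)
    have "degree (D l) \<le> e" if "l \<ge> 1" for l
      using top[of "Suc e" l] Suc.prems(1) that
      by (metis degree_0 le_0_eq le_SucE leading_coeff_0_iff zero_le)
    then show ?case using Suc by blast
  qed
  have "D n = 0"
    by (rule vanish[OF _ n, of "card I"])
      (auto simp: D_def intro: degree_diff_le degree_floor_poly_le)
  then show ?thesis by (simp add: D_def)
qed

lemma proots_floor_poly:
  assumes I: "finite I" and a: "\<And>i. i \<in> I \<Longrightarrow> a i \<noteq> 0"
  shows "proots (floor_poly I a n) = image_mset (\<lambda>i. frac (real n * a i) / a i) (mset_set I)"
proof -
  have "proots [:- frac (real n * a i), a i:] = {#frac (real n * a i) / a i#}" if "i \<in> I" for i
  proof -
    have "[:- frac (real n * a i), a i:] = smult (a i) [:- (frac (real n * a i) / a i), 1:]"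
      using a[OF that] by simp
    then show ?thesis using a[OF that] by (simp del: smult_pCons)
  qed
  then have "proots (floor_poly I a n) = (\<Sum>i\<in>I. {#frac (real n * a i) / a i#})"
    unfolding floor_poly_def using a by (subst proots_prod) auto
  also have "\<dots> = image_mset (\<lambda>i. frac (real n * a i) / a i) (mset_set I)"
    using I by (induction I rule: finite_induct) auto
  finally show ?thesis .
qed

section \<open>Recovering numbers from their scaled fractional parts\<close>

text \<open>
  Let \<open>m\<close> be such that \<open>frac (m x)\<close> is near \<open>1\<close> and \<open>m y\<close> is near an
  integer for each \<open>y\<close> in \<open>T\<close>. Some \<open>y\<close> in \<open>T\<close> satisfies
  \<open>frac (m x) / x = frac (m y) / y\<close>. The left side is near \<open>1 / x\<close> and the right side near
  \<open>0\<close> or \<open>1 / y\<close>; when \<open>y \<noteq> x\<close>, both are impossible for a sufficiently small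
  error, and finiteness of \<open>T\<close> lets one error bound serve all \<open>y\<close>.
\<close>

lemma scaled_frac_irrational_common:
  fixes S T :: "real set"
  assumes fin: "finite S" "finite T"
    and nz: "\<And>y. y \<in> T \<Longrightarrow> y \<noteq> 0"
    and sub: "\<And>n::nat. n \<ge> 1 \<Longrightarrow> (\<lambda>x. frac (real n * x) / x) ` S \<subseteq> (\<lambda>x. frac (real n * x) / x) ` T"
    and x: "x \<in> S" "x \<notin> \<rat>"
  shows "x \<in> T"
proof (rule ccontr)
  assume "x \<notin> T"
  have x0: "x \<noteq> 0" using x by auto
  \<comment> \<open>The second bound excludes that \<open>m y\<close> is just above an integer, the third that it is just below one.\<close>
  have "\<forall>\<^sub>F \<epsilon> in at_right 0. \<epsilon> < 1 \<and> \<epsilon> * (\<bar>x\<bar> + \<bar>y\<bar>) < \<bar>y\<bar> \<and> \<epsilon> * (\<bar>x\<bar> + \<bar>y - x\<bar>) < \<bar>y - x\<bar>" if "y \<in> T" for y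
  proof -
    have lim: "((\<lambda>\<epsilon>. \<epsilon> * c) \<longlongrightarrow> 0) (at_right 0)" for c :: real
      by (auto intro!: tendsto_eq_intros)
    show ?thesis
      using order_tendstoD(2)[OF lim[of 1], of 1] order_tendstoD(2)[OF lim[of "\<bar>x\<bar> + \<bar>y\<bar>"], of "\<bar>y\<bar>"]
        order_tendstoD(2)[OF lim[of "\<bar>x\<bar> + \<bar>y - x\<bar>"], of "\<bar>y - x\<bar>"] nz[OF that] \<open>x \<notin> T\<close> that
      by (auto intro!: eventually_conj)
  qed
  then have "\<forall>\<^sub>F \<epsilon> in at_right 0. \<epsilon> > 0 \<and> (\<forall>y\<in>T. \<epsilon> < 1 \<and> \<epsilon> * (\<bar>x\<bar> + \<bar>y\<bar>) < \<bar>y\<bar> \<and> \<epsilon> * (\<bar>x\<bar> + \<bar>y - x\<bar>) < \<bar>y - x\<bar>)"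
    using fin(2) by (intro eventually_conj eventually_at_right_less eventually_ball_finite) auto
  from eventually_happens'[OF _ this] obtain \<epsilon> :: real where \<epsilon>: "\<epsilon> > 0"
    and small: "\<And>y. y \<in> T \<Longrightarrow> \<epsilon> < 1" "\<And>y. y \<in> T \<Longrightarrow> \<epsilon> * (\<bar>x\<bar> + \<bar>y\<bar>) < \<bar>y\<bar>"
      "\<And>y. y \<in> T \<Longrightarrow> \<epsilon> * (\<bar>x\<bar> + \<bar>y - x\<bar>) < \<bar>y - x\<bar>"
    by auto
  obtain m where m: "m \<ge> 1" and mx: "frac (real m * x) > 1 - \<epsilon>"
    and my: "\<And>y. y \<in> T \<Longrightarrow> frac (real m * y) < \<epsilon> \<or> frac (real m * y) > 1 - \<epsilon>"
    using irrational_recurrence_from_below[of T \<epsilon> x] fin \<epsilon> x(2) by metis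
  obtain y where y: "y \<in> T" and eq: "frac (real m * x) / x = frac (real m * y) / y"
    using sub[OF m] x(1) by blast
  define s t where "s = frac (real m * x)" and "t = frac (real m * y)"
  have st: "t * x = s * y"
    using eq x0 nz[OF y] by (simp add: s_def t_def field_simps)
  have s: "1 - \<epsilon> < s" "s < 1" using mx by (auto simp: s_def frac_lt_1)
  have t: "0 \<le> t" "t < 1" by (auto simp: t_def frac_lt_1)
  from my[OF y] consider "t < \<epsilon>" | "t > 1 - \<epsilon>" by (auto simp: t_def)
  then show False
  proof cases
    case 1
    have "(1 - \<epsilon>) * \<bar>y\<bar> \<le> s * \<bar>y\<bar>" using s by (intro mult_right_mono) auto
    also have "\<dots> = t * \<bar>x\<bar>" using st s t small(1)[OF y] by (metis abs_mult abs_of_nonneg abs_of_pos diff_gt_0_iff_gt less_trans)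
    also have "\<dots> \<le> \<epsilon> * \<bar>x\<bar>" using 1 by (intro mult_right_mono) auto
    finally show False using small(2)[OF y] by (simp add: algebra_simps)
  next
    case 2
    have "(1 - \<epsilon>) * \<bar>y - x\<bar> \<le> s * \<bar>y - x\<bar>" using s by (intro mult_right_mono) auto
    also have "\<dots> = \<bar>s * (y - x)\<bar>" using s small(1)[OF y] by (simp add: abs_mult)
    also have "s * (y - x) = (t - s) * x" using st by (simp add: algebra_simps)
    also have "\<bar>\<dots>\<bar> \<le> \<epsilon> * \<bar>x\<bar>" unfolding abs_mult using 2 s t by (intro mult_right_mono) auto
    finally show False using small(3)[OF y] by (simp add: algebra_simps)
  qed
qed

lemma scaled_frac_fraction:
  fixes p q :: int and n :: nat
  assumes "q > 0"
  shows "frac (real n * (of_int p / of_int q)) / (of_int p / of_int q) = of_int ((int n * p) mod q) / of_int p"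
proof -
  have "real n * (of_int p / of_int q) = of_int (int n * p) / of_int q" by simp
  moreover have "\<lfloor>of_int (int n * p) / (of_int q :: real)\<rfloor> = (int n * p) div q"
    by (rule floor_divide_of_int_eq)
  moreover have "of_int (int n * p) = (of_int (int n * p div q * q + int n * p mod q) :: real)"
    by (simp only: div_mult_mod_eq)
  ultimately have "frac (real n * (of_int p / of_int q)) = of_int ((int n * p) mod q) / of_int q"
    using assms unfolding frac_def of_int_add of_int_mult by (simp add: field_simps)
  then show ?thesis using assms by simp
qed

text \<open>
  Choose \<open>n\<close> with \<open>n p \<equiv> j (mod q)\<close>, so that \<open>x = p / q\<close> has scaled
  fractional part \<open>j / p\<close>, where \<open>j\<close> is the largest number below \<open>q\<close> coprime to
  \<open>p\<close>. If \<open>y = p' / q'\<close> attains the same value, as \<open>a / p'\<close> with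
  \<open>0 \<le> a < q'\<close>, then \<open>p\<close> divides \<open>p'\<close>, so maximality of \<open>\<bar>p\<bar>\<close>
  and the signs give \<open>p' = p\<close> and \<open>a = j\<close>. Now \<open>q'\<close> is coprime to \<open>p\<close>,
  exceeds \<open>j\<close> and is at most \<open>q\<close>, so the choice of \<open>j\<close> forces
  \<open>q' = q\<close>.
\<close>

lemma extremal_fraction_common:
  fixes U T :: "real set" and p q :: "real \<Rightarrow> int"
  assumes T: "T \<subseteq> U"
    and rep: "\<And>y. y \<in> U \<Longrightarrow> y = of_int (p y) / of_int (q y)" "\<And>y. y \<in> U \<Longrightarrow> q y > 0"
      "\<And>y. y \<in> U \<Longrightarrow> coprime (p y) (q y)"
    and nonint: "\<And>y. y \<in> U \<Longrightarrow> y \<notin> \<int>"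
    and x: "x \<in> U" and sub: "\<And>n::nat. n \<ge> 1 \<Longrightarrow> frac (real n * x) / x \<in> (\<lambda>y. frac (real n * y) / y) ` T"
    and max_num: "\<And>y. y \<in> U \<Longrightarrow> \<bar>p y\<bar> \<le> \<bar>p x\<bar>"
    and max_den: "\<And>y. y \<in> U \<Longrightarrow> \<bar>p y\<bar> = \<bar>p x\<bar> \<Longrightarrow> q y \<le> q x"
  shows "x \<in> T"
proof -
  have p0: "p y \<noteq> 0" if "y \<in> U" for y
    using rep(1)[OF that] nonint[OF that] by auto
  have "q x \<noteq> 1"
    using rep(1)[OF x] nonint[OF x] by (metis Ints_of_int div_by_1 of_int_1)
  then have q: "q x \<ge> 2" using rep(2)[OF x] by simp
  define J where "J = {j. 1 \<le> j \<and> j < q x \<and> coprime j (p x)}"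
  have "J \<subseteq> {1..q x}" by (auto simp: J_def)
  then have J: "finite J" by (rule finite_subset) simp
  have "1 \<in> J" using q by (simp add: J_def)
  define j where "j = Max J"
  have "j \<in> J" unfolding j_def using J \<open>1 \<in> J\<close> by (intro Max_in) auto
  then have j: "1 \<le> j" "j < q x" "coprime j (p x)" by (auto simp: J_def)
  have j_max: "i \<le> j" if "i \<in> J" for i unfolding j_def using J that by (rule Max_ge)
  obtain c where c: "[p x * c = 1] (mod q x)"
    using cong_solve_coprime_int[OF rep(3)[OF x]] by blast
  \<comment> \<open>Adding \<open>q x\<close> keeps the residue class and makes \<open>n\<close> positive.\<close>
  define n where "n = nat ((c * j) mod q x + q x)"
  have "0 \<le> (c * j) mod q x" using rep(2)[OF x] by simp
  then have n_int: "int n = (c * j) mod q x + q x" and n: "n \<ge> 1"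
    using rep(2)[OF x] unfolding n_def by linarith+
  have "[int n * p x = c * j * p x] (mod q x)"
    unfolding n_int by (intro cong_mult cong_refl) (simp add: cong_def)
  also have "c * j * p x = j * (p x * c)" by simp
  also have "[\<dots> = j * 1] (mod q x)" using c by (intro cong_mult cong_refl)
  finally have "(int n * p x) mod q x = j" using j by (simp add: cong_def)
  then have fx: "frac (real n * x) / x = of_int j / of_int (p x)"
    using scaled_frac_fraction[OF rep(2)[OF x], of n "p x"]
    unfolding rep(1)[OF x, symmetric] by simp
  obtain y where y: "y \<in> T" and xy: "frac (real n * x) / x = frac (real n * y) / y"
    using sub[OF n] by blast
  have yU: "y \<in> U" using y T by blast
  define a where "a = (int n * p y) mod q y"
  have a: "0 \<le> a" "a < q y" using rep(2)[OF yU] by (auto simp: a_def)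
  have fy: "frac (real n * y) / y = of_int a / of_int (p y)"
    using scaled_frac_fraction[OF rep(2)[OF yU], of n "p y"]
    unfolding rep(1)[OF yU, symmetric] a_def .
  have "(of_int j / of_int (p x) :: real) = of_int a / of_int (p y)" using fx fy xy by simp
  then have "(of_int (j * p y) :: real) = of_int (a * p x)"
    using p0[OF x] p0[OF yU] by (simp add: field_simps)
  then have cross: "j * p y = a * p x" by (simp only: of_int_eq_iff)
  then have "p x dvd j * p y" by simp
  then have "p x dvd p y"
    using j(3) by (simp add: coprime_commute coprime_dvd_mult_right_iff)
  then have abs: "\<bar>p y\<bar> = \<bar>p x\<bar>"
    using max_num[OF yU] p0[OF yU] by (simp add: dvd_imp_le_int order_antisym)
  have "\<not> p y = - p x"
  proof
    assume "p y = - p x"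
    then have "(a + j) * p x = 0" using cross by (simp add: algebra_simps)
    then show False using p0[OF x] a(1) j(1) by simp
  qed
  then have p_eq: "p y = p x" using abs by (auto simp: abs_eq_iff)
  then have "a = j" using cross p0[OF x] by simp
  have "q y = q x"
  proof (rule ccontr)
    assume "q y \<noteq> q x"
    then have "q y \<in> J"
      using max_den[OF yU abs] rep(2,3)[OF yU] p_eq by (simp add: J_def coprime_commute)
    from j_max[OF this] show False using a(2) \<open>a = j\<close> by simp
  qed
  then have "y = x" using p_eq rep(1)[OF x] rep(1)[OF yU] by simp
  then show ?thesis using y by simp
qed

lemma scaled_frac_images_common_element:
  fixes S T :: "real set"
  assumes fin: "finite S" "finite T" and ne: "S \<union> T \<noteq> {}"
    and nonint: "\<And>x. x \<in> S \<union> T \<Longrightarrow> x \<notin> \<int>"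
    and img: "\<And>n::nat. n \<ge> 1 \<Longrightarrow> (\<lambda>x. frac (real n * x) / x) ` S = (\<lambda>x. frac (real n * x) / x) ` T"
  shows "S \<inter> T \<noteq> {}"
proof (cases "S \<union> T \<subseteq> \<rat>")
  case False
  then obtain x where x: "x \<in> S \<union> T" "x \<notin> \<rat>" by blast
  have nz: "y \<noteq> 0" if "y \<in> S \<union> T" for y using nonint[OF that] by auto
  have "x \<in> S \<inter> T"
    using scaled_frac_irrational_common[of S T x] scaled_frac_irrational_common[of T S x]
      fin nz img x by blast
  then show ?thesis by blast
next
  case True
  define U where "U = S \<union> T"
  have U: "finite U" "U \<noteq> {}" using fin ne by (auto simp: U_def)
  have "\<exists>p q::int. x = of_int p / of_int q \<and> q > 0 \<and> coprime p q" if "x \<in> U" for x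
  proof -
    have "x \<in> \<rat>" using that True by (auto simp: U_def)
    then show ?thesis by (metis Rats_cases')
  qed
  then obtain p q :: "real \<Rightarrow> int" where rep: "\<And>x. x \<in> U \<Longrightarrow> x = of_int (p x) / of_int (q x)"
    "\<And>x. x \<in> U \<Longrightarrow> q x > 0" "\<And>x. x \<in> U \<Longrightarrow> coprime (p x) (q x)"
    by metis
  define m where "m = Max ((\<lambda>x. \<bar>p x\<bar>) ` U)"
  define V where "V = {x \<in> U. \<bar>p x\<bar> = m}"
  have m: "\<bar>p y\<bar> \<le> m" if "y \<in> U" for y using that U by (simp add: m_def)
  have "m \<in> (\<lambda>x. \<bar>p x\<bar>) ` U" unfolding m_def using U by (intro Max_in) auto
  then have V: "finite V" "V \<noteq> {}" using U by (auto simp: V_def)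
  then have "Max (q ` V) \<in> q ` V" by (intro Max_in) auto
  then obtain x where x: "x \<in> V" "q x = Max (q ` V)" by auto
  have ext: "x \<in> U" "\<And>y. y \<in> U \<Longrightarrow> \<bar>p y\<bar> \<le> \<bar>p x\<bar>" "\<And>y. y \<in> U \<Longrightarrow> \<bar>p y\<bar> = \<bar>p x\<bar> \<Longrightarrow> q y \<le> q x"
    using x m V(1) by (auto simp: V_def)
  have common: "x \<in> R'" if "x \<in> R" "R' \<subseteq> U"
    and "\<And>n::nat. n \<ge> 1 \<Longrightarrow> (\<lambda>x. frac (real n * x) / x) ` R = (\<lambda>x. frac (real n * x) / x) ` R'" for R R'
  proof (rule extremal_fraction_common[of R' U p q x])
    show "frac (real n * x) / x \<in> (\<lambda>y. frac (real n * y) / y) ` R'" if "n \<ge> 1" for n :: nat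
      using \<open>x \<in> R\<close> \<open>n \<ge> 1\<close> \<open>\<And>n::nat. n \<ge> 1 \<Longrightarrow> (\<lambda>x. frac (real n * x) / x) ` R = (\<lambda>x. frac (real n * x) / x) ` R'\<close>
      by blast
  qed (use that rep nonint ext in \<open>auto simp: U_def\<close>)
  have "x \<in> S \<inter> T"
    using ext(1) common[of S T] common[of T S] img by (auto simp: U_def)
  then show ?thesis by blast
qed

text \<open>
  Removing the common part preserves the hypothesis, because image multisets are additive and
  cancellative. What is left of the two multisets is disjoint, so it must be empty.
\<close>

lemma multiset_eq_if_scaled_frac_multisets_eq:
  fixes A B :: "real multiset"
  assumes nonint: "\<And>x. x \<in># A + B \<Longrightarrow> x \<notin> \<int>"
    and img: "\<And>n::nat. n \<ge> 1 \<Longrightarrow>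
      image_mset (\<lambda>x. frac (real n * x) / x) A = image_mset (\<lambda>x. frac (real n * x) / x) B"
  shows "A = B"
proof (rule ccontr)
  assume "A \<noteq> B"
  have disj: "set_mset (A - B) \<inter> set_mset (B - A) = {}"
    by (auto simp: in_diff_count)
  have "set_mset (A - B) \<inter> set_mset (B - A) \<noteq> {}"
  proof (rule scaled_frac_images_common_element)
    show "set_mset (A - B) \<union> set_mset (B - A) \<noteq> {}"
      using \<open>A \<noteq> B\<close> by (auto simp: Diff_eq_empty_iff_mset)
    show "x \<notin> \<int>" if "x \<in> set_mset (A - B) \<union> set_mset (B - A)" for x
      using that nonint by (auto dest: in_diffD)
    fix n :: nat assume n: "n \<ge> 1"
    let ?f = "\<lambda>x. frac (real n * x) / x"
    have "(A - B) + (A \<inter># B) = A" "(B - A) + (A \<inter># B) = B"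
      by (rule multiset_eqI, simp)+
    then have "image_mset ?f (A - B) + image_mset ?f (A \<inter># B)
        = image_mset ?f (B - A) + image_mset ?f (A \<inter># B)"
      using img[OF n] by (simp flip: image_mset_union)
    then have "image_mset ?f (A - B) = image_mset ?f (B - A)" by simp
    then show "?f ` set_mset (A - B) = ?f ` set_mset (B - A)" by (metis set_image_mset)
  qed simp_all
  with disj show False by simp
qed

section \<open>Equal products of floors\<close>

theorem theorem2:
  fixes \<alpha> \<beta> :: "real ^ 'd"
  assumes "\<And>n::nat. n \<ge> 1 \<Longrightarrow>
    (\<Prod>i\<in>UNIV. \<lfloor>real n * \<alpha> $ i\<rfloor>) = (\<Prod>i\<in>UNIV. \<lfloor>real n * \<beta> $ i\<rfloor>)"
  shows "(\<exists>i. \<alpha> $ i \<in> \<int>) \<or>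
    image_mset (\<lambda>i. \<alpha> $ i) (mset_set UNIV) = image_mset (\<lambda>i. \<beta> $ i) (mset_set UNIV)"
proof (cases "\<exists>i. \<alpha> $ i \<in> \<int>")
  case False
  then have \<alpha>: "\<alpha> $ i \<notin> \<int>" for i by blast
  then have \<alpha>0: "\<alpha> $ i \<noteq> 0" for i by (metis Ints_0)
  have eq: "floor_poly UNIV (($) \<alpha>) n = floor_poly UNIV (($) \<beta>) n" if "n \<ge> 1" for n
    by (rule floor_poly_eq_if_floor_products_eq) (use assms that in auto)
  have "floor_poly UNIV (($) \<alpha>) 1 \<noteq> 0"
    using \<alpha>0 by (simp add: floor_poly_def)
  then have "floor_poly UNIV (($) \<beta>) 1 \<noteq> 0" using eq[of 1] by simp
  \<comment> \<open>A zero among the \<open>\<beta> $ i\<close> would contribute a zero factor.\<close>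
  then have "[:- frac (real 1 * \<beta> $ i), \<beta> $ i:] \<noteq> 0" for i
    unfolding floor_poly_def by (metis UNIV_I finite prod_zero)
  then have \<beta>0: "\<beta> $ i \<noteq> 0" for i
    by (metis Ints_0 frac_eq_0_iff minus_zero mult_zero_right pCons_0_0)
  let ?A = "image_mset (($) \<alpha>) (mset_set UNIV)" and ?B = "image_mset (($) \<beta>) (mset_set UNIV)"
  have img: "image_mset (\<lambda>x. frac (real n * x) / x) ?A = image_mset (\<lambda>x. frac (real n * x) / x) ?B"
    if "n \<ge> 1" for n
  proof -
    have "image_mset (\<lambda>i. frac (real n * \<alpha> $ i) / \<alpha> $ i) (mset_set UNIV)
        = proots (floor_poly UNIV (($) \<alpha>) n)"
      by (rule proots_floor_poly[symmetric]) (rule finite, rule \<alpha>0)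
    also have "\<dots> = proots (floor_poly UNIV (($) \<beta>) n)"
      by (simp only: eq[OF that])
    also have "\<dots> = image_mset (\<lambda>i. frac (real n * \<beta> $ i) / \<beta> $ i) (mset_set UNIV)"
      by (rule proots_floor_poly) (rule finite, rule \<beta>0)
    finally show ?thesis
      by (simp only: multiset.map_comp o_def)
  qed
  have \<beta>: "\<beta> $ i \<notin> \<int>" for i
  proof
    assume "\<beta> $ i \<in> \<int>"
    then have "frac (real 1 * \<beta> $ i) / \<beta> $ i = 0" by simp
    moreover have "frac (real 1 * \<beta> $ i) / \<beta> $ i \<in> (\<lambda>x. frac (real 1 * x) / x) ` set_mset ?B"
      by (rule imageI) simp
    ultimately have "0 \<in># image_mset (\<lambda>x. frac (real 1 * x) / x) ?B"
      by (simp only: set_image_mset)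
    then have "0 \<in># image_mset (\<lambda>x. frac (real 1 * x) / x) ?A"
      by (simp only: img[OF order_refl])
    then obtain j where "frac (real 1 * \<alpha> $ j) / \<alpha> $ j = 0" by auto
    then show False using \<alpha>[of j] \<alpha>0[of j] by simp
  qed
  have "?A = ?B"
    by (rule multiset_eq_if_scaled_frac_multisets_eq) (use \<alpha> \<beta> img in auto)
  then show ?thesis by simp
qed blast

end
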